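(* For every $0 \le \theta < 1/4$ we have $f(\theta) = 1/2$.
   Context: For $0 \le \theta < 1/2$, let $f(\theta)$ denote the least (infimum of) exponent $\phi \ge 0$ with the following property: there exist constants $c_1, c_2 > 0$ (which may depend on $\theta$) such that for every real $x \ge 1$ the interval $[x - c_1 x^{\phi}, x + c_1 x^{\phi}]$ contains an integer $n$ with $n = ab$, where $a$ and $b$ are integers lying in the interval $[x^{1/2} - c_2 x^{\theta}, x^{1/2} + c_2 x^{\theta}]$. (Since perfect squares have gaps of size $O(\sqrt{x})$, one has $0 \le f(\theta) \le 1/2$.) *)

theory Defs
  imports Complex_Main
begin

definition admissible_exponent :: "real \<Rightarrow> real \<Rightarrow> bool" where
  "admissible_exponent \<theta> \<phi> \<longleftrightarrow>
     (\<exists>c1 c2 :: real. c1 > 0 \<and> c2 > 0 \<and>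
       (\<forall>x::real. x \<ge> 1 \<longrightarrow>
         (\<exists>n a b :: int. n = a * b \<and>
            of_int n \<in> {x - c1 * x powr \<phi> .. x + c1 * x powr \<phi>} \<and>
            of_int a \<in> {x powr (1/2) - c2 * x powr \<theta> .. x powr (1/2) + c2 * x powr \<theta>} \<and>
            of_int b \<in> {x powr (1/2) - c2 * x powr \<theta> .. x powr (1/2) + c2 * x powr \<theta>})))"

text \<open>
  Only meaningful for \<open>0 \<le> \<theta> < 1/2\<close>. There the set is bounded below by \<open>0\<close> and contains
  \<open>1/2\<close> (take \<open>a = b = \<lfloor>sqrt x\<rfloor>\<close>), so that the real \<open>Inf\<close> is a genuine infimum.
\<close>
definition f :: "real \<Rightarrow> real" where
  "f \<theta> = Inf {\<phi>. \<phi> \<ge> 0 \<and> admissible_exponent \<theta> \<phi>}"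

end

theory Submission
  imports Defs "HOL-Real_Asymp.Real_Asymp"
begin

text \<open>
  Since \<open>4ab = (a+b)\<^sup>2 - (a-b)\<^sup>2\<close>, a product of two integers within \<open>c\<^sub>2 x\<^sup>\<theta>\<close> of \<open>\<surd>x\<close> lies
  within \<open>c\<^sub>2\<^sup>2 x\<^bsup>2\<theta>\<^esup>\<close> of a quarter square \<open>s\<^sup>2/4\<close>. For \<open>\<theta> < 1/4\<close> this is \<open>o(\<surd>x)\<close>, whereas
  consecutive quarter squares near \<open>x\<close> are about \<open>\<surd>x\<close> apart. Points halfway between them in the
  square root scale, \<open>\<surd>x = (2m+1)/4\<close>, stay at distance at least \<open>\<surd>x/4\<close> from every \<open>s\<^sup>2/4\<close>.
\<close>

text \<open>Factor \<open>16 * (s^2/4 - y^2)\<close> as \<open>(2|s| - 4y) (2|s| + 4y)\<close>: the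
  first factor is an odd integer, so at least 1 in absolute value, and the second is at least
  \<open>4y\<close>. Using \<open>|s|\<close> avoids a case split on the sign of
  \<open>s\<close>.\<close>

lemma quarter_square_distance:
  fixes s m :: int
  assumes "m \<ge> 0"
  defines "y \<equiv> (2 * real_of_int m + 1) / 4"
  shows "y / 4 \<le> \<bar>(real_of_int s)\<^sup>2 / 4 - y\<^sup>2\<bar>"
proof -
  have "1 \<le> \<bar>2 * \<bar>s\<bar> - (2 * m + 1)\<bar>" by presburger
  then have "real_of_int 1 \<le> real_of_int \<bar>2 * \<bar>s\<bar> - (2 * m + 1)\<bar>"
    by (simp only: of_int_le_iff)
  then have "1 \<le> \<bar>2 * \<bar>real_of_int s\<bar> - 4 * y\<bar>"
    by (simp add: y_def add_divide_distrib)
  moreover have "0 \<le> y" using assms by simp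
  ultimately have "1 * (4 * y) \<le> \<bar>2 * \<bar>real_of_int s\<bar> - 4 * y\<bar> * (2 * \<bar>real_of_int s\<bar> + 4 * y)"
    by (intro mult_mono) auto
  also have "\<dots> = \<bar>(2 * \<bar>real_of_int s\<bar> - 4 * y) * (2 * \<bar>real_of_int s\<bar> + 4 * y)\<bar>"
    using \<open>0 \<le> y\<close> by (simp add: abs_mult)
  also have "(2 * \<bar>real_of_int s\<bar> - 4 * y) * (2 * \<bar>real_of_int s\<bar> + 4 * y)
      = 16 * ((real_of_int s)\<^sup>2 / 4 - y\<^sup>2)"
    by (simp add: algebra_simps power2_eq_square)
  also have "\<bar>\<dots>\<bar> = 16 * \<bar>(real_of_int s)\<^sup>2 / 4 - y\<^sup>2\<bar>"
    by (simp only: abs_mult abs_numeral)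
  finally show ?thesis by simp
qed

lemma product_quarter_square_distance:
  fixes a b y d :: real
  assumes "\<bar>a - y\<bar> \<le> d" "\<bar>b - y\<bar> \<le> d"
  shows "\<bar>a * b - (a + b)\<^sup>2 / 4\<bar> \<le> d\<^sup>2"
proof -
  have "(a - b)\<^sup>2 \<le> (2 * d)\<^sup>2"
    using assms by (intro abs_le_square_iff[THEN iffD1]) linarith
  moreover have "a * b - (a + b)\<^sup>2 / 4 = - ((a - b)\<^sup>2 / 4)"
    by (simp add: power2_eq_square field_simps)
  ultimately show ?thesis by (simp add: power_mult_distrib)
qed

text \<open>After division by \<open>y\<close> both exponents are negative, so the sum tends to 0.
  With \<open>p = 2 * \<phi>\<close> and \<open>q = 4 * \<theta>\<close> this is where
  \<open>\<phi> < 1/2\<close> and \<open>\<theta> < 1/4\<close> enter.\<close>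

lemma eventually_powr_sum_less:
  fixes p q A B :: real
  assumes "p < 1" "q < 1"
  shows "\<forall>\<^sub>F y in at_top. A * y powr p + B * y powr q < y"
proof -
  have "((\<lambda>y. A * y powr (p - 1) + B * y powr (q - 1)) \<longlongrightarrow> A * 0 + B * 0) at_top"
    using assms by (intro tendsto_intros tendsto_neg_powr filterlim_ident) auto
  then have "\<forall>\<^sub>F y in at_top. A * y powr (p - 1) + B * y powr (q - 1) < 1"
    by (rule order_tendstoD) simp
  then show ?thesis
    using eventually_gt_at_top[of 0]
    by eventually_elim (simp add: powr_diff field_simps)
qed

lemma admissible_exponent_half:
  assumes "0 \<le> \<theta>"
  shows "admissible_exponent \<theta> (1/2)"
proof -
  \<comment> \<open>For \<open>a = b = floor y\<close> with \<open>y = sqrt x\<close>, the constant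
    1 suffices because \<open>|a - y| \<le> 1 \<le> x powr \<theta>\<close>, and 2 because
    \<open>y^2 - a^2 = (y - a) (y + a) \<le> 2y\<close>.\<close>
  have "\<exists>n a b :: int. n = a * b \<and>
      of_int n \<in> {x - 2 * x powr (1/2) .. x + 2 * x powr (1/2)} \<and>
      of_int a \<in> {x powr (1/2) - 1 * x powr \<theta> .. x powr (1/2) + 1 * x powr \<theta>} \<and>
      of_int b \<in> {x powr (1/2) - 1 * x powr \<theta> .. x powr (1/2) + 1 * x powr \<theta>}"
    if "x \<ge> 1" for x :: real
  proof -
    define y where "y = x powr (1/2)"
    define a where "a = \<lfloor>y\<rfloor>"
    have x: "x = y * y"
      using that by (simp add: y_def flip: powr_add)
    have y: "y \<ge> 1" and t: "x powr \<theta> \<ge> 1"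
      using that assms by (simp_all add: y_def ge_one_powr_ge_zero)
    have a: "real_of_int a \<le> y" "y < real_of_int a + 1"
      unfolding a_def by linarith+
    have a0: "0 \<le> real_of_int a" using y by (simp add: a_def)
    have "real_of_int a * real_of_int a \<le> y * y"
      using a a0 by (intro mult_mono) auto
    moreover have "(y - a) * (y + a) \<le> 1 * (2 * y)"
      using a a0 y by (intro mult_mono) auto
    ultimately have "real_of_int (a * a) \<in> {x - 2 * y .. x + 2 * y}"
      using y by (simp add: x algebra_simps)
    moreover have "real_of_int a \<in> {y - 1 * x powr \<theta> .. y + 1 * x powr \<theta>}"
      using a t by auto
    ultimately show ?thesis unfolding y_def by blast
  qed
  then show ?thesis
    unfolding admissible_exponent_def
    by (intro exI[of _ 2] exI[of _ 1]) auto
qed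

lemma admissible_exponent_ge_half:
  assumes "\<theta> < 1/4" "admissible_exponent \<theta> \<phi>"
  shows "1/2 \<le> \<phi>"
proof (rule ccontr)
  assume "\<not> 1/2 \<le> \<phi>"
  then have \<phi>: "2 * \<phi> < 1" by simp
  obtain c1 c2 :: real where H: "\<And>x::real. x \<ge> 1 \<Longrightarrow>
         \<exists>n a b :: int. n = a * b \<and>
            of_int n \<in> {x - c1 * x powr \<phi> .. x + c1 * x powr \<phi>} \<and>
            of_int a \<in> {x powr (1/2) - c2 * x powr \<theta> .. x powr (1/2) + c2 * x powr \<theta>} \<and>
            of_int b \<in> {x powr (1/2) - c2 * x powr \<theta> .. x powr (1/2) + c2 * x powr \<theta>}"
    using assms(2) unfolding admissible_exponent_def by blast
  \<comment> \<open>The exponents are doubled because \<open>x = y^2\<close>; the factors 4 match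
    the lower bound \<open>y / 4\<close> on the distance.\<close>
  have "\<forall>\<^sub>F y in at_top. 4 * c1 * y powr (2 * \<phi>) + 4 * c2\<^sup>2 * y powr (4 * \<theta>) < y"
    using \<phi> assms(1) by (intro eventually_powr_sum_less) auto
  moreover have "filterlim (\<lambda>m::nat. (2 * real m + 1) / 4) at_top sequentially"
    by real_asymp
  ultimately have "\<forall>\<^sub>F m::nat in sequentially. (let y = (2 * real m + 1) / 4 in
      4 * c1 * y powr (2 * \<phi>) + 4 * c2\<^sup>2 * y powr (4 * \<theta>) < y)"
    unfolding Let_def by (rule eventually_compose_filterlim)
  \<comment> \<open>\<open>m \<ge> 2\<close> forces \<open>y \<ge> 5/4\<close>, so that
    \<open>x = y^2\<close> lies in the range \<open>x \<ge> 1\<close>; \<open>m = 1\<close> would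
    only give \<open>y = 3/4\<close>.\<close>
  then have "\<forall>\<^sub>F m::nat in sequentially. m \<ge> 2 \<and> (let y = (2 * real m + 1) / 4 in
      4 * c1 * y powr (2 * \<phi>) + 4 * c2\<^sup>2 * y powr (4 * \<theta>) < y)"
    using eventually_ge_at_top[of 2] by eventually_elim simp
  then obtain m :: nat where m: "m \<ge> 2" "(let y = (2 * real m + 1) / 4 in
      4 * c1 * y powr (2 * \<phi>) + 4 * c2\<^sup>2 * y powr (4 * \<theta>) < y)"
    using eventually_happens by force
  define y where "y = (2 * real m + 1) / 4"
  have y: "y \<ge> 1" using m by (simp add: y_def)
  have less: "4 * c1 * y powr (2 * \<phi>) + 4 * c2\<^sup>2 * y powr (4 * \<theta>) < y"
    using m(2) by (simp add: Let_def y_def)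
  have pow: "(y\<^sup>2) powr r = y powr (2 * r)" for r
    using y by (simp add: powr_powr flip: powr_numeral)
  obtain a b :: int where ab:
      "\<bar>real_of_int a * real_of_int b - y\<^sup>2\<bar> \<le> c1 * y powr (2 * \<phi>)"
      "\<bar>real_of_int a - y\<bar> \<le> c2 * y powr (2 * \<theta>)"
      "\<bar>real_of_int b - y\<bar> \<le> c2 * y powr (2 * \<theta>)"
    using H[of "y\<^sup>2"] y unfolding pow by (auto simp: abs_le_iff algebra_simps)
  have "\<bar>real_of_int a * real_of_int b - (real_of_int a + real_of_int b)\<^sup>2 / 4\<bar>
      \<le> (c2 * y powr (2 * \<theta>))\<^sup>2"
    using ab by (intro product_quarter_square_distance)
  also have "\<dots> = c2\<^sup>2 * y powr (4 * \<theta>)"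
    by (simp add: power2_eq_square flip: powr_add)
  finally have "\<bar>real_of_int a * real_of_int b - (real_of_int a + real_of_int b)\<^sup>2 / 4\<bar>
      \<le> c2\<^sup>2 * y powr (4 * \<theta>)" .
  moreover have "y / 4 \<le> \<bar>(real_of_int a + real_of_int b)\<^sup>2 / 4 - y\<^sup>2\<bar>"
    using quarter_square_distance[of "int m" "a + b"] by (simp add: y_def)
  \<comment> \<open>By the triangle inequality through \<open>a * b\<close>, \<open>y / 4\<close> is
    at most \<open>c1 * y powr (2 * \<phi>) + c2^2 * y powr (4 * \<theta>)\<close>, which is less
    than \<open>y / 4\<close>.\<close>
  ultimately show False using ab(1) less by linarith
qed

theorem theorem1:
  fixes \<theta> :: real
  assumes "0 \<le> \<theta>" and "\<theta> < 1/4"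
  shows "f \<theta> = 1/2"
  unfolding f_def
  using assms admissible_exponent_half admissible_exponent_ge_half
  \<comment> \<open>The infimum is attained: 1/2 is itself admissible.\<close>
  by (intro cInf_eq_minimum) auto

end
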